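(* Let $0<\eta<1$ and let $M>0$. Let $\{x_n\}\subset\ell_2$ be a sequence with $\mathcal{R}_\eta(x_n)\le M$ for all $n$. If $x_n$ converges weakly in $\ell_2$ to $x\in\ell_2$ and $\mathcal{R}_\eta(x_n)\to\mathcal{R}_\eta(x)$, then $x_n$ converges strongly to $x$ in $\ell_2$.
   Context: $\ell_2$ is the real Hilbert space of square-summable sequences indexed by $\mathbb{N}$, and $\|x\|_{\ell_1}=\sum_i|x_i|\in[0,+\infty]$ for $x\in\ell_2$. The functional $\mathcal{R}_\eta:\ell_2\to[0,+\infty]$ is $\mathcal{R}_\eta(x)=\|x\|_{\ell_1}^2-\eta\|x\|_{\ell_2}^2$, with value $+\infty$ when $x\notin\ell_1$. *)

theory Defs
  imports "HOL-Analysis.Analysis"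
begin

typedef ell2 = "{x :: nat \<Rightarrow> real. summable (\<lambda>i. (x i)\<^sup>2)}"
  morphisms coord Abs_ell2
proof
  show "(\<lambda>_. 0) \<in> {x :: nat \<Rightarrow> real. summable (\<lambda>i. (x i)\<^sup>2)}" by simp
qed

setup_lifting type_definition_ell2

lemma summable_coord_power2: "summable (\<lambda>i. (coord x i)\<^sup>2)"
  using coord [of x] by simp

lemma summable_mult_of_power2:
  fixes f g :: "nat \<Rightarrow> real"
  assumes "summable (\<lambda>i. (f i)\<^sup>2)" "summable (\<lambda>i. (g i)\<^sup>2)"
  shows "summable (\<lambda>i. f i * g i)"
proof (rule summable_comparison_test')
  show "summable (\<lambda>i. (f i)\<^sup>2 + (g i)\<^sup>2)"
    using assms by (rule summable_add)
  fix i :: nat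
  have "2 * (\<bar>f i\<bar> * \<bar>g i\<bar>) \<le> (f i)\<^sup>2 + (g i)\<^sup>2"
    using sum_squares_bound [of "\<bar>f i\<bar>" "\<bar>g i\<bar>"] by simp
  moreover have "0 \<le> \<bar>f i\<bar> * \<bar>g i\<bar>" by simp
  ultimately show "norm (f i * g i) \<le> (f i)\<^sup>2 + (g i)\<^sup>2"
    unfolding real_norm_def abs_mult by linarith
qed

lemma summable_coord_mult: "summable (\<lambda>i. coord x i * coord y i)"
  by (intro summable_mult_of_power2 summable_coord_power2)

lemma summable_power2_add:
  fixes f g :: "nat \<Rightarrow> real"
  assumes "summable (\<lambda>i. (f i)\<^sup>2)" "summable (\<lambda>i. (g i)\<^sup>2)"
  shows "summable (\<lambda>i. (f i + g i)\<^sup>2)"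
proof -
  have "summable (\<lambda>i. (f i)\<^sup>2 + (g i)\<^sup>2 + 2 * (f i * g i))"
    using assms by (intro summable_add summable_mult summable_mult_of_power2)
  then show ?thesis by (simp add: power2_sum mult.assoc)
qed

instantiation ell2 :: real_inner
begin

lift_definition zero_ell2 :: ell2 is "\<lambda>_. 0" by simp

lift_definition plus_ell2 :: "ell2 \<Rightarrow> ell2 \<Rightarrow> ell2" is "\<lambda>x y i. x i + y i"
  by (rule summable_power2_add)

lift_definition uminus_ell2 :: "ell2 \<Rightarrow> ell2" is "\<lambda>x i. - x i" by simp

lift_definition minus_ell2 :: "ell2 \<Rightarrow> ell2 \<Rightarrow> ell2" is "\<lambda>x y i. x i - y i"
proof -
  fix f g :: "nat \<Rightarrow> real"
  assume "summable (\<lambda>i. (f i)\<^sup>2)" "summable (\<lambda>i. (g i)\<^sup>2)"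
  then show "summable (\<lambda>i. (f i - g i)\<^sup>2)"
    using summable_power2_add [of f "\<lambda>i. - g i"] by simp
qed

lift_definition scaleR_ell2 :: "real \<Rightarrow> ell2 \<Rightarrow> ell2" is "\<lambda>c x i. c * x i"
  by (simp add: power_mult_distrib summable_mult)

lift_definition inner_ell2 :: "ell2 \<Rightarrow> ell2 \<Rightarrow> real" is "\<lambda>x y. \<Sum>i. x i * y i" .

definition norm_ell2 :: "ell2 \<Rightarrow> real" where
  "norm x = sqrt (\<Sum>i. (coord x i)\<^sup>2)"

definition dist_ell2 :: "ell2 \<Rightarrow> ell2 \<Rightarrow> real" where
  "dist (x :: ell2) y = norm (x - y)"

definition sgn_ell2 :: "ell2 \<Rightarrow> ell2" where
  "sgn (x :: ell2) = inverse (norm x) *\<^sub>R x"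

definition uniformity_ell2 :: "(ell2 \<times> ell2) filter" where
  "uniformity = (INF e\<in>{0<..}. principal {(x, y :: ell2). dist x y < e})"

definition open_ell2 :: "ell2 set \<Rightarrow> bool" where
  "open (U :: ell2 set) \<longleftrightarrow> (\<forall>x\<in>U. \<forall>\<^sub>F (x', y) in uniformity. x' = x \<longrightarrow> y \<in> U)"

instance
proof
  fix x y z :: ell2 and a b :: real and U :: "ell2 set"
  show "x + y + z = x + (y + z)" by transfer (simp add: add.assoc)
  show "x + y = y + x" by transfer (simp add: add.commute)
  show "0 + x = x" by transfer simp
  show "- x + x = 0" by transfer simp
  show "x - y = x + - y" by transfer simp
  show "a *\<^sub>R (x + y) = a *\<^sub>R x + a *\<^sub>R y" by transfer (simp add: distrib_left)
  show "(a + b) *\<^sub>R x = a *\<^sub>R x + b *\<^sub>R x" by transfer (simp add: distrib_right)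
  show "a *\<^sub>R b *\<^sub>R x = (a * b) *\<^sub>R x" by transfer (simp add: mult.assoc)
  show "1 *\<^sub>R x = x" by transfer simp
  show "dist x y = norm (x - y)" by (rule dist_ell2_def)
  show "sgn x = inverse (norm x) *\<^sub>R x" by (rule sgn_ell2_def)
  show "uniformity = (INF e\<in>{0<..}. principal {(x, y :: ell2). dist x y < e})"
    by (rule uniformity_ell2_def)
  show "open U \<longleftrightarrow> (\<forall>x\<in>U. \<forall>\<^sub>F (x', y) in uniformity. x' = x \<longrightarrow> y \<in> U)"
    by (rule open_ell2_def)
  show "inner x y = inner y x" by transfer (simp add: mult.commute)
  show "inner (x + y) z = inner x z + inner y z"
    by transfer (simp add: distrib_right suminf_add summable_mult_of_power2)
  show "inner (a *\<^sub>R x) y = a * inner x y"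
    by transfer (simp add: mult.assoc suminf_mult summable_mult_of_power2)
  show "0 \<le> inner x x"
    by transfer (simp add: suminf_nonneg flip: power2_eq_square)
  show "inner x x = 0 \<longleftrightarrow> x = 0"
    by transfer (simp add: suminf_eq_zero_iff fun_eq_iff flip: power2_eq_square)
  show "norm x = sqrt (inner x x)"
    unfolding norm_ell2_def by transfer (simp add: power2_eq_square)
qed

end

definition weakly_converges_to :: "(nat \<Rightarrow> 'a :: real_normed_vector) \<Rightarrow> 'a \<Rightarrow> bool" where
  "weakly_converges_to X l \<longleftrightarrow>
     (\<forall>f :: 'a \<Rightarrow> real. bounded_linear f \<longrightarrow> (\<lambda>n. f (X n)) \<longlonglongrightarrow> f l)"

text \<open>The nonnegative series is summed in the extended reals, so it is \<open>\<infinity>\<close>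
  exactly when it diverges.\<close>
definition l1_norm :: "ell2 \<Rightarrow> ereal" where
  "l1_norm x = (\<Sum>i. ereal \<bar>coord x i\<bar>)"

text \<open>The subtrahend is always finite, so the difference is \<open>\<infinity>\<close> outside
  \<open>\<ell>\<^sub>1\<close>. Extended real subtraction does not truncate at \<open>0\<close>: for
  \<open>\<eta> \<le> 1\<close> nonnegativity is a theorem, shown below.\<close>
definition R_fun :: "real \<Rightarrow> ell2 \<Rightarrow> ereal" where
  "R_fun \<eta> x = (l1_norm x)\<^sup>2 - ereal (\<eta> * (norm x)\<^sup>2)"

lemma l1_norm_summable:
  assumes "summable (\<lambda>i. \<bar>coord x i\<bar>)"
  shows "l1_norm x = ereal (\<Sum>i. \<bar>coord x i\<bar>)"
  unfolding l1_norm_def using assms by (simp add: suminf_ereal')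

lemma l1_norm_not_summable:
  assumes "\<not> summable (\<lambda>i. \<bar>coord x i\<bar>)"
  shows "l1_norm x = \<infinity>"
proof (rule ccontr)
  assume "l1_norm x \<noteq> \<infinity>"
  then have "summable (\<lambda>i. \<bar>coord x i\<bar>)"
    unfolding l1_norm_def by (intro summable_ereal) auto
  with assms show False by simp
qed

lemma R_fun_not_summable:
  assumes "\<not> summable (\<lambda>i. \<bar>coord x i\<bar>)"
  shows "R_fun \<eta> x = \<infinity>"
  using assms by (simp add: R_fun_def l1_norm_not_summable)

lemma R_fun_summable:
  assumes "summable (\<lambda>i. \<bar>coord x i\<bar>)"
  shows "R_fun \<eta> x = ereal ((\<Sum>i. \<bar>coord x i\<bar>)\<^sup>2 - \<eta> * (norm x)\<^sup>2)"
  using assms by (simp add: R_fun_def l1_norm_summable)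

lemma R_fun_nonneg:
  assumes "\<eta> \<le> 1"
  shows "0 \<le> R_fun \<eta> x"
proof (cases "summable (\<lambda>i. \<bar>coord x i\<bar>)")
  case True
  define s where "s = (\<Sum>i. \<bar>coord x i\<bar>)"
  have le: "\<bar>coord x i\<bar> \<le> s" for i
    using sum_le_suminf [OF True, of "{i}"] by (simp add: s_def)
  have "(norm x)\<^sup>2 = (\<Sum>i. (coord x i)\<^sup>2)"
    by (simp add: norm_ell2_def suminf_nonneg summable_coord_power2)
  also have "\<dots> \<le> (\<Sum>i. s * \<bar>coord x i\<bar>)"
  proof (rule suminf_le)
    show "(coord x i)\<^sup>2 \<le> s * \<bar>coord x i\<bar>" for i
      using mult_right_mono [OF le, of "\<bar>coord x i\<bar>" i] by (simp add: power2_eq_square)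
  qed (auto intro: summable_coord_power2 summable_mult True)
  also have "\<dots> = s\<^sup>2"
    using True by (simp add: suminf_mult s_def power2_eq_square)
  finally have "(norm x)\<^sup>2 \<le> s\<^sup>2" .
  moreover have "\<eta> * (norm x)\<^sup>2 \<le> 1 * (norm x)\<^sup>2"
    using assms by (intro mult_right_mono) auto
  ultimately show ?thesis
    using True by (simp add: R_fun_summable s_def)
next
  case False
  then show ?thesis by (simp add: R_fun_not_summable)
qed

end

theory Submission
  imports Defs
begin

text \<open>For \<open>x \<in> \<ell>\<^sub>1\<close> the functional splits as
  \<open>R_fun \<eta> x = J x + (1 - \<eta>) * \<parallel>x\<parallel>\<^sup>2\<close> with \<open>J x = \<parallel>x\<parallel>\<^sub>1\<^sup>2 - \<parallel>x\<parallel>\<^sup>2\<close>. Formally \<open>J x\<close> is the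
  off-diagonal double series \<open>\<Sum>i\<noteq>j. \<bar>x\<^sub>i\<bar> * \<bar>x\<^sub>j\<bar>\<close>. Its terms are nonnegative, so \<open>J\<close> is the
  supremum of its finite sections, each of which depends continuously on finitely many
  coordinates; hence \<open>J\<close> is weakly lower semicontinuous. If \<open>R_fun \<eta> (X n)\<close> converges to the
  finite value \<open>R_fun \<eta> x\<close>, then no mass is left over for the other summand:
  \<open>limsup \<parallel>X n\<parallel>\<^sup>2 \<le> \<parallel>x\<parallel>\<^sup>2\<close>, because \<open>1 - \<eta> > 0\<close>. In a Hilbert space this together with weak
  convergence gives strong convergence, by expanding \<open>\<parallel>X n - x\<parallel>\<^sup>2\<close>.

  The bound \<open>M\<close> passes to the limit, so \<open>R_fun \<eta>\<close> is finite at \<open>x\<close> and at every \<open>X n\<close>; all these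
  points lie in \<open>\<ell>\<^sub>1\<close>, where the splitting is available.\<close>

lemma norm_ell2_power2: "(norm (x :: ell2))\<^sup>2 = (\<Sum>i. (coord x i)\<^sup>2)"
  by (simp add: norm_ell2_def suminf_nonneg summable_coord_power2)

lemma weakly_converges_to_inner:
  fixes X :: "nat \<Rightarrow> 'a :: real_inner"
  assumes "weakly_converges_to X x"
  shows "(\<lambda>n. inner (X n) y) \<longlonglongrightarrow> inner x y"
  using assms bounded_linear_inner_left [of y] unfolding weakly_converges_to_def by blast

text \<open>Coordinates are inner products with the standard unit vectors.\<close>

lemma weakly_converges_to_coord:
  assumes "weakly_converges_to X x"
  shows "(\<lambda>n. coord (X n) i) \<longlonglongrightarrow> coord x i"
proof -
  define e where "e = Abs_ell2 (\<lambda>j. if j = i then 1 else 0)"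
  have "(\<lambda>j. (if j = i then 1 else 0 :: real)\<^sup>2) sums (\<Sum>j\<in>{i}. (if j = i then 1 else 0)\<^sup>2)"
    by (rule sums_finite) auto
  then have coord_e: "coord e = (\<lambda>j. if j = i then 1 else 0)"
    unfolding e_def by (subst Abs_ell2_inverse) (auto dest: sums_summable)
  have "inner y e = coord y i" for y
  proof -
    have "inner y e = (\<Sum>j. coord y j * coord e j)"
      by transfer simp
    also have "\<dots> = (\<Sum>j\<in>{i}. coord y j * coord e j)"
      by (rule suminf_finite) (auto simp: coord_e)
    finally show ?thesis by (simp add: coord_e)
  qed
  then show ?thesis
    using weakly_converges_to_inner [OF assms, of e] by simp
qed

text \<open>This is \<open>\<Sum>\<bar>x\<^sub>i\<bar> * \<bar>x\<^sub>j\<bar>\<close> over the pairs \<open>i \<noteq> j\<close> below \<open>N\<close>: the square of the sum minus the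
  diagonal.\<close>
definition offdiag_sum :: "nat \<Rightarrow> ell2 \<Rightarrow> real" where
  "offdiag_sum N x = (\<Sum>i<N. \<bar>coord x i\<bar>)\<^sup>2 - (\<Sum>i<N. (coord x i)\<^sup>2)"

text \<open>Passing from \<open>N\<close> to \<open>N + 1\<close> adds the nonnegative cross terms
  \<open>2 * \<bar>x\<^sub>N\<bar> * \<Sum>i<N. \<bar>x\<^sub>i\<bar>\<close>.\<close>
lemma incseq_offdiag_sum: "incseq (\<lambda>N. offdiag_sum N x)"
proof (rule incseq_SucI)
  fix N
  have "0 \<le> 2 * ((\<Sum>i<N. \<bar>coord x i\<bar>) * \<bar>coord x N\<bar>)"
    by (simp add: sum_nonneg)
  then show "offdiag_sum N x \<le> offdiag_sum (Suc N) x"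
    by (simp add: offdiag_sum_def power2_sum)
qed

lemma offdiag_sum_tendsto:
  assumes "summable (\<lambda>i. \<bar>coord x i\<bar>)"
  shows "(\<lambda>N. offdiag_sum N x) \<longlonglongrightarrow> (\<Sum>i. \<bar>coord x i\<bar>)\<^sup>2 - (norm x)\<^sup>2"
  unfolding offdiag_sum_def norm_ell2_power2
  by (intro tendsto_intros summable_LIMSEQ assms summable_coord_power2)

lemma weakly_converges_to_offdiag_sum:
  assumes "weakly_converges_to X x"
  shows "(\<lambda>n. offdiag_sum N (X n)) \<longlonglongrightarrow> offdiag_sum N x"
  unfolding offdiag_sum_def
  by (intro tendsto_intros weakly_converges_to_coord assms)

lemma R_fun_offdiag_split:
  assumes "R_fun \<eta> x \<noteq> \<infinity>"
  obtains r where "R_fun \<eta> x = ereal r"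
    and "(\<lambda>N. offdiag_sum N x) \<longlonglongrightarrow> r - (1 - \<eta>) * (norm x)\<^sup>2"
proof
  have *: "summable (\<lambda>i. \<bar>coord x i\<bar>)"
    using assms R_fun_not_summable by blast
  show "R_fun \<eta> x = ereal ((\<Sum>i. \<bar>coord x i\<bar>)\<^sup>2 - \<eta> * (norm x)\<^sup>2)"
    using * by (rule R_fun_summable)
  show "(\<lambda>N. offdiag_sum N x)
      \<longlonglongrightarrow> (\<Sum>i. \<bar>coord x i\<bar>)\<^sup>2 - \<eta> * (norm x)\<^sup>2 - (1 - \<eta>) * (norm x)\<^sup>2"
    using offdiag_sum_tendsto [OF *] by (simp add: algebra_simps)
qed

theorem lemma2p9:
  fixes \<eta> M :: real and X :: "nat \<Rightarrow> ell2" and x :: ell2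
  assumes "0 < \<eta>" and "\<eta> < 1" and "M > 0"
    and "\<And>n. R_fun \<eta> (X n) \<le> ereal M"
    and "weakly_converges_to X x"
    and "(\<lambda>n. R_fun \<eta> (X n)) \<longlonglongrightarrow> R_fun \<eta> x"
  shows "X \<longlonglongrightarrow> x"
proof -
  note bounded = assms(4) and weak = assms(5) and lim = assms(6)
  have "R_fun \<eta> x \<le> ereal M"
    using lim bounded by (intro LIMSEQ_le_const2 [where X = "\<lambda>n. R_fun \<eta> (X n)"]) auto
  then have "R_fun \<eta> x \<noteq> \<infinity>" by auto
  then obtain r where r: "R_fun \<eta> x = ereal r"
    and offdiag_x: "(\<lambda>N. offdiag_sum N x) \<longlonglongrightarrow> r - (1 - \<eta>) * (norm x)\<^sup>2"
    by (rule R_fun_offdiag_split)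
  have "\<exists>s. R_fun \<eta> (X n) = ereal s
      \<and> (\<lambda>N. offdiag_sum N (X n)) \<longlonglongrightarrow> s - (1 - \<eta>) * (norm (X n))\<^sup>2" for n
  proof -
    have "R_fun \<eta> (X n) \<noteq> \<infinity>" using bounded [of n] by auto
    then show ?thesis by (rule R_fun_offdiag_split) blast
  qed
  then obtain s where s: "\<And>n. R_fun \<eta> (X n) = ereal (s n)"
    and offdiag_X: "\<And>n. (\<lambda>N. offdiag_sum N (X n)) \<longlonglongrightarrow> s n - (1 - \<eta>) * (norm (X n))\<^sup>2"
    by metis
  have s_lim: "s \<longlonglongrightarrow> r"
    using lim by (simp add: s r)

  have "(\<lambda>n. (1 - \<eta>) * (norm (X n - x))\<^sup>2) \<longlonglongrightarrow> 0"
  proof (rule tendstoI)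
    fix \<epsilon> :: real
    assume "0 < \<epsilon>"
    then have "r - (1 - \<eta>) * (norm x)\<^sup>2 - \<epsilon> < r - (1 - \<eta>) * (norm x)\<^sup>2" by simp
    from order_tendstoD(1) [OF offdiag_x this]
    obtain N where "r - (1 - \<eta>) * (norm x)\<^sup>2 - \<epsilon> < offdiag_sum N x"
      by (auto simp: eventually_sequentially)
    then have N: "r - offdiag_sum N x - (1 - \<eta>) * (norm x)\<^sup>2 < \<epsilon>"
      by linarith
    \<comment> \<open>Cutting the off-diagonal series of \<open>X n\<close> at \<open>N\<close> gives an upper bound for
      \<open>(1 - \<eta>) * \<parallel>X n - x\<parallel>\<^sup>2\<close> that involves only quantities with known limits; its limit is
      the off-diagonal remainder of \<open>x\<close> beyond \<open>N\<close>, which is less than \<open>\<epsilon>\<close>.\<close>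
    define g where
      "g n = s n - offdiag_sum N (X n) - (1 - \<eta>) * (2 * inner (X n) x - (norm x)\<^sup>2)" for n
    have bound: "(1 - \<eta>) * (norm (X n - x))\<^sup>2 \<le> g n" for n
    proof -
      have "offdiag_sum N (X n) \<le> s n - (1 - \<eta>) * (norm (X n))\<^sup>2"
        using incseq_offdiag_sum offdiag_X by (rule incseq_le)
      moreover have "(norm (X n - x))\<^sup>2 = (norm (X n))\<^sup>2 - (2 * inner (X n) x - (norm x)\<^sup>2)"
        by (simp add: power2_norm_eq_inner inner_diff_left inner_diff_right inner_commute)
      ultimately show ?thesis
        by (simp add: g_def right_diff_distrib)
    qed
    have "g \<longlonglongrightarrow> r - offdiag_sum N x - (1 - \<eta>) * (2 * inner x x - (norm x)\<^sup>2)"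
      unfolding g_def
      by (intro tendsto_intros s_lim weakly_converges_to_offdiag_sum
          weakly_converges_to_inner weak)
    then have "g \<longlonglongrightarrow> r - offdiag_sum N x - (1 - \<eta>) * (norm x)\<^sup>2"
      by (simp add: power2_norm_eq_inner)
    then have "\<forall>\<^sub>F n in sequentially. g n < \<epsilon>"
      using N by (rule order_tendstoD(2))
    then show "\<forall>\<^sub>F n in sequentially. dist ((1 - \<eta>) * (norm (X n - x))\<^sup>2) 0 < \<epsilon>"
    proof eventually_elim
      case (elim n)
      with bound [of n] \<open>\<eta> < 1\<close> show ?case by (simp add: abs_mult)
    qed
  qed
  then have "(\<lambda>n. (1 / (1 - \<eta>)) * ((1 - \<eta>) * (norm (X n - x))\<^sup>2)) \<longlonglongrightarrow> 1 / (1 - \<eta>) * 0"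
    by (rule tendsto_mult_left)
  then have "(\<lambda>n. (norm (X n - x))\<^sup>2) \<longlonglongrightarrow> 0"
    using \<open>\<eta> < 1\<close> by simp
  then have "(\<lambda>n. sqrt ((norm (X n - x))\<^sup>2)) \<longlonglongrightarrow> sqrt 0"
    by (rule tendsto_real_sqrt)
  then have "(\<lambda>n. norm (X n - x)) \<longlonglongrightarrow> 0" by simp
  then show ?thesis
    by (metis LIM_zero_cancel tendsto_norm_zero_cancel)
qed

end
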